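(* Let $\phi$ be a Koopman eigenfunction of $\dot{x} = f(x)$ with eigenvalue $\lambda \in \mathbb{C}$, and let $M \subseteq X$. If there are constants $\epsilon, C$ with $0 < \epsilon \le \phi(x) \le C$ for all $x \in M$, if $\mathrm{Re}(\lambda) \ne 0$, and if $\lim_{t \to \infty} F^t(x)$ is defined (for $x \in M$), then any trajectory that enters $M$ will exit $M$; that is, for every $x \in M$ there is some $t > 0$ with $F^t(x) \notin M$.
   Context: Consider $\dot{x} = f(x)$, $x \in X \subset \mathbb{R}^d$, with $f : \mathbb{R}^d \to \mathbb{R}^d$ sufficiently smooth to guarantee existence and uniqueness of solutions. $F^t(x_0)$ denotes the flow, i.e. the solution at time $t$ starting from $x_0$ at time $0$. $X$ is compact and forward invariant under $F^t$. The Koopman operator acts on observables $g : X \to \mathbb{C}$ by $\mathcal{K}^t g = g \circ F^t$. A function $\phi : X \to \mathbb{C}$ is a (Koopman) eigenfunction with eigenvalue $\lambda \in \mathbb{C}$ if $\mathcal{K}^t\phi = e^{\lambda t}\phi$ for all $t$, i.e. $\phi(F^t(x)) = e^{\lambda t}\phi(x)$. Eigenfunctions are not assumed continuous or bounded unless stated. *)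

theory Defs
  imports "HOL-Analysis.Analysis"
begin

definition solves_ode :: "(real ^ 'd \<Rightarrow> real ^ 'd) \<Rightarrow> real set \<Rightarrow> (real \<Rightarrow> real ^ 'd) \<Rightarrow> bool" where
  "solves_ode f T x \<longleftrightarrow> (\<forall>t\<in>T. (x has_vector_derivative f (x t)) (at t within T))"

text \<open>
  "Sufficiently smooth to guarantee existence and uniqueness of solutions" is rendered by the
  guarantee itself (plus continuity), not by a particular sufficient condition such as
  a local Lipschitz bound. Existence is local, since smoothness does not exclude blow-up.
\<close>

definition well_posed :: "(real ^ 'd \<Rightarrow> real ^ 'd) \<Rightarrow> bool" where
  "well_posed f \<longleftrightarrow>
     continuous_on UNIV f \<and>
     (\<forall>x0. \<exists>r>0. \<exists>x. solves_ode f {-r<..<r} x \<and> x 0 = x0) \<and>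
     (\<forall>T x y. is_interval T \<and> 0 \<in> T \<and> solves_ode f T x \<and> solves_ode f T y \<and> x 0 = y 0
        \<longrightarrow> (\<forall>t\<in>T. x t = y t))"

text \<open>
  Only the values \<open>F t x\<close> with \<open>x \<in> X\<close> and \<open>t \<ge> 0\<close> are specified; for well-posed \<open>f\<close> they are
  determined uniquely. Backward in time a trajectory may leave \<open>X\<close> or blow up.
\<close>

definition is_flow_on ::
  "(real ^ 'd \<Rightarrow> real ^ 'd) \<Rightarrow> (real ^ 'd) set \<Rightarrow> (real \<Rightarrow> real ^ 'd \<Rightarrow> real ^ 'd) \<Rightarrow> bool" where
  "is_flow_on f X F \<longleftrightarrow> (\<forall>x\<in>X. solves_ode f {0..} (\<lambda>t. F t x) \<and> F 0 x = x)"

definition forward_invariant ::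
  "(real \<Rightarrow> real ^ 'd \<Rightarrow> real ^ 'd) \<Rightarrow> (real ^ 'd) set \<Rightarrow> bool" where
  "forward_invariant F X \<longleftrightarrow> (\<forall>t\<ge>0. F t ` X \<subseteq> X)"

definition koopman ::
  "(real \<Rightarrow> real ^ 'd \<Rightarrow> real ^ 'd) \<Rightarrow> real \<Rightarrow> (real ^ 'd \<Rightarrow> complex) \<Rightarrow> (real ^ 'd \<Rightarrow> complex)" where
  "koopman F t g = g \<circ> F t"

text \<open>
  Observables on \<open>X\<close> are total functions whose values outside \<open>X\<close> are irrelevant.
\<close>

definition koopman_eigenfunction ::
  "(real \<Rightarrow> real ^ 'd \<Rightarrow> real ^ 'd) \<Rightarrow> (real ^ 'd) set \<Rightarrow> (real ^ 'd \<Rightarrow> complex) \<Rightarrow> complex \<Rightarrow> bool" where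
  "koopman_eigenfunction F X \<phi> \<mu> \<longleftrightarrow>
     (\<forall>t\<ge>0. \<forall>x\<in>X. koopman F t \<phi> x = exp (\<mu> * of_real t) * \<phi> x)"

end

theory Submission imports Defs begin

text \<open>
  Along a trajectory the modulus of an eigenfunction is exactly exponential,
  \<open>\<bar>\<phi> (F t x)\<bar> = e\<^sup>a\<^sup>t \<bar>\<phi> x\<bar>\<close> with \<open>a = Re \<mu>\<close>, whereas on \<open>M\<close> the modulus is confined to the
  interval \<open>[\<epsilon>, C]\<close>. Two values in this interval have a ratio between \<open>\<epsilon> / C\<close> and \<open>C / \<epsilon>\<close>, so as
  soon as \<open>\<bar>a\<bar> t > ln (C / \<epsilon>)\<close> the points \<open>x\<close> and \<open>F t x\<close> cannot both lie in \<open>M\<close>. The exit time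
  obtained in this way is the same for all points of \<open>M\<close>.
\<close>

lemma norm_koopman_eigenfunction:
  assumes "koopman_eigenfunction F X \<phi> \<mu>" "x \<in> X" "t \<ge> 0"
  shows "norm (\<phi> (F t x)) = exp (Re \<mu> * t) * norm (\<phi> x)"
proof -
  have "\<phi> (F t x) = exp (\<mu> * of_real t) * \<phi> x"
    using assms by (simp add: koopman_eigenfunction_def koopman_def)
  then show ?thesis
    by (simp add: norm_mult)
qed

theorem mainTheorem4:
  fixes f :: "real ^ 'd \<Rightarrow> real ^ 'd"
    and F :: "real \<Rightarrow> real ^ 'd \<Rightarrow> real ^ 'd"
    and X M :: "(real ^ 'd) set"
    and \<phi> :: "real ^ 'd \<Rightarrow> complex"
    and \<mu> :: complex
    and \<epsilon> C :: real
  assumes "well_posed f"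
    and "compact X"
    and "is_flow_on f X F"
    and "forward_invariant F X"
    and "koopman_eigenfunction F X \<phi> \<mu>"
    and "M \<subseteq> X"
    and "0 < \<epsilon>"
    and "\<And>x. x \<in> M \<Longrightarrow> \<phi> x \<in> \<real> \<and> \<epsilon> \<le> Re (\<phi> x) \<and> Re (\<phi> x) \<le> C"
    and "Re \<mu> \<noteq> 0"
    and "\<And>x. x \<in> M \<Longrightarrow> \<exists>l. ((\<lambda>t. F t x) \<longlongrightarrow> l) at_top"
  shows "\<forall>x\<in>M. \<exists>t>0. F t x \<notin> M"
proof
  fix x assume x: "x \<in> M"
  have bounds: "\<epsilon> \<le> norm (\<phi> y) \<and> norm (\<phi> y) \<le> C" if "y \<in> M" for y
    using assms(8)[OF that] assms(7) by (auto simp: in_Reals_norm complex_is_Real_iff cmod_eq_Re)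
  have "\<epsilon> \<le> C"
    using bounds[OF x] by linarith
  \<comment> \<open>The summand 1 makes the growth strictly exceed \<open>C / \<epsilon>\<close>, and \<open>t\<close> positive even if \<open>C = \<epsilon>\<close>.\<close>
  define t where "t = (ln (C / \<epsilon>) + 1) / \<bar>Re \<mu>\<bar>"
  have "ln (C / \<epsilon>) \<ge> 0"
    using \<open>\<epsilon> \<le> C\<close> assms(7) by simp
  then have "t > 0"
    using assms(9) by (simp add: t_def)
  have "C / \<epsilon> < exp (\<bar>Re \<mu>\<bar> * t)"
  proof -
    have "C / \<epsilon> = exp (ln (C / \<epsilon>))"
      using \<open>\<epsilon> \<le> C\<close> assms(7) by simp
    also have "\<dots> < exp (\<bar>Re \<mu>\<bar> * t)"
      using assms(9) by (simp add: t_def)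
    finally show ?thesis .
  qed
  then have growth: "C < exp (\<bar>Re \<mu>\<bar> * t) * \<epsilon>"
    using assms(7) by (simp add: field_simps)
  have step: "norm (\<phi> (F t x)) = exp (Re \<mu> * t) * norm (\<phi> x)"
    using norm_koopman_eigenfunction[OF assms(5)] x assms(6) \<open>t > 0\<close> by force
  have "F t x \<notin> M"
  proof
    assume Ftx: "F t x \<in> M"
    \<comment> \<open>For decay the roles of the two points are exchanged: the modulus grows backward in time.\<close>
    obtain y z where "y \<in> M" "z \<in> M" and yz: "norm (\<phi> z) = exp (\<bar>Re \<mu>\<bar> * t) * norm (\<phi> y)"
    proof (cases "Re \<mu> > 0")
      case True
      then show ?thesis
        using that[OF x Ftx] step by simp
    next
      case False
      then have "norm (\<phi> x) = exp (\<bar>Re \<mu>\<bar> * t) * norm (\<phi> (F t x))"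
        by (simp add: step exp_minus)
      then show ?thesis
        using that[OF Ftx x] by simp
    qed
    have "C < exp (\<bar>Re \<mu>\<bar> * t) * \<epsilon>"
      by (fact growth)
    also have "\<dots> \<le> norm (\<phi> z)"
      using bounds[OF \<open>y \<in> M\<close>] by (simp add: yz)
    also have "\<dots> \<le> C"
      using bounds[OF \<open>z \<in> M\<close>] by simp
    finally show False by simp
  qed
  with \<open>t > 0\<close> show "\<exists>t>0. F t x \<notin> M"
    by blast
qed

end
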